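(* Let $p$ be an odd prime, and let $\{A_k\}_{k\ge0}$ be an odd sequence all of whose terms are rational $p$-integers. Then $$\sum_{k=1}^{p-1}\frac{A_k}{p+k}\equiv 0\pmod{p^2}.$$
   Context: A sequence $\{a_n\}_{n\ge0}$ is called an odd sequence if $\sum_{k=0}^n\binom nk(-1)^ka_k=-a_n$ for all $n=0,1,2,\ldots$. A rational $p$-integer is a rational number whose denominator (in lowest terms) is coprime to $p$; $\mathbb Z_p$ denotes the ring of such numbers, and for $x,y\in\mathbb Z_p$, $x\equiv y\pmod{p^2}$ means $(x-y)/p^2\in\mathbb Z_p$. *)

theory Defs
  imports Complex_Main "HOL-Computational_Algebra.Primes"
begin

definition odd_sequence :: "(nat \<Rightarrow> 'a::comm_ring_1) \<Rightarrow> bool" where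
  "odd_sequence a \<longleftrightarrow>
     (\<forall>n. (\<Sum>k=0..n. of_nat (n choose k) * (-1) ^ k * a k) = - a n)"

text \<open>\<^const>\<open>quotient_of\<close> returns numerator and (positive) denominator in lowest terms.\<close>

definition p_integers :: "nat \<Rightarrow> rat set" where
  "p_integers p = {x. coprime (snd (quotient_of x)) (int p)}"

text \<open>The congruence is one between members of \<^term>\<open>p_integers p\<close>, so membership of both sides
  is part of the definition.\<close>

definition p_cong :: "nat \<Rightarrow> nat \<Rightarrow> rat \<Rightarrow> rat \<Rightarrow> bool" where
  "p_cong p m x y \<longleftrightarrow>
     x \<in> p_integers p \<and> y \<in> p_integers p \<and> (x - y) / of_nat p ^ m \<in> p_integers p"

end

(* Interchanging the order of summation in the defining identity of an odd sequence turns
   sum A_k/(p+k) into - sum (-1)^k A_k S_k, where S_k = sum_{n<p} (n choose k)/(p+n).  The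
   congruence S_k = (-1)^k/(p+k) (mod p^2) for 0 < k < p then shows that the sum is congruent to
   its own negative.  That congruence follows by descending induction on k from the recursion
   (p+k) S_k + (k+1) S_{k+1} = (p choose k+1). *)
theory Submission imports Defs
begin

section \<open>Rational p-integers\<close>

text \<open>The reduced denominator divides every other denominator of the same number, so any
  fraction with denominator coprime to \<open>p\<close> witnesses membership. Closure properties
  then follow without reducing fractions.\<close>

lemma p_integers_iff:
  "x \<in> p_integers p \<longleftrightarrow> (\<exists>a b. coprime b (int p) \<and> b \<noteq> 0 \<and> x = of_int a / of_int b)"
proof
  assume "x \<in> p_integers p"
  moreover obtain a b where ab: "quotient_of x = (a, b)" by (cases "quotient_of x")
  moreover have "x = of_int a / of_int b" "b > 0"
    using ab by (simp_all add: quotient_of_div quotient_of_denom_pos)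
  ultimately show "\<exists>a b. coprime b (int p) \<and> b \<noteq> 0 \<and> x = of_int a / of_int b"
    by (intro exI[of _ a] exI[of _ b]) (auto simp: p_integers_def)
next
  assume "\<exists>a b. coprime b (int p) \<and> b \<noteq> 0 \<and> x = of_int a / of_int b"
  then obtain a b where b: "coprime b (int p)" "b \<noteq> 0" and x: "x = of_int a / of_int b" by blast
  obtain c d where cd: "quotient_of x = (c, d)" by (cases "quotient_of x")
  have xd: "x = of_int c / of_int d" and d: "d > 0" and cop: "coprime c d"
    using cd by (simp_all add: quotient_of_div quotient_of_denom_pos quotient_of_coprime)
  have "(of_int (c * b) :: rat) = of_int (a * d)"
    using x xd b d by (simp add: field_simps)
  hence "c * b = a * d" by (simp only: of_int_eq_iff)
  \<comment> \<open>Since \<open>c\<close> and \<open>d\<close> are in lowest terms,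
    \<open>d\<close> must divide the factor \<open>b\<close> and inherits its coprimality to
    \<open>p\<close>.\<close>
  hence "d dvd c * b" by simp
  hence "d dvd b" using cop by (simp add: coprime_dvd_mult_right_iff coprime_commute)
  hence "coprime d (int p)" using b(1) by (rule coprime_divisors[OF _ dvd_refl])
  thus "x \<in> p_integers p" using cd by (simp add: p_integers_def)
qed

lemma p_integers_of_int [simp]: "of_int a \<in> p_integers p"
  unfolding p_integers_iff by (rule exI[of _ a], rule exI[of _ 1]) simp

lemma p_integers_of_nat [simp]: "of_nat a \<in> p_integers p"
  using p_integers_of_int[of "int a" p] by simp

lemma p_integers_0 [simp]: "0 \<in> p_integers p"
  using p_integers_of_nat[of 0 p] by simp

lemma p_integers_1 [simp]: "1 \<in> p_integers p"
  using p_integers_of_nat[of 1 p] by simp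

lemma p_integers_add [intro]:
  assumes "x \<in> p_integers p" "y \<in> p_integers p"
  shows "x + y \<in> p_integers p"
proof -
  obtain a b c d where "coprime b (int p)" "b \<noteq> 0" "x = of_int a / of_int b"
    and "coprime d (int p)" "d \<noteq> 0" "y = of_int c / of_int d"
    using assms unfolding p_integers_iff by blast
  thus ?thesis unfolding p_integers_iff
    by (intro exI[of _ "a * d + c * b"] exI[of _ "b * d"]) (simp add: field_simps)
qed

lemma p_integers_mult [intro]:
  assumes "x \<in> p_integers p" "y \<in> p_integers p"
  shows "x * y \<in> p_integers p"
proof -
  obtain a b c d where "coprime b (int p)" "b \<noteq> 0" "x = of_int a / of_int b"
    and "coprime d (int p)" "d \<noteq> 0" "y = of_int c / of_int d"
    using assms unfolding p_integers_iff by blast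
  thus ?thesis unfolding p_integers_iff
    by (intro exI[of _ "a * c"] exI[of _ "b * d"]) simp
qed

lemma p_integers_uminus [intro]: "x \<in> p_integers p \<Longrightarrow> - x \<in> p_integers p"
  using p_integers_mult[OF p_integers_of_int[of "- 1"], of x p] by simp

lemma p_integers_sum [intro]:
  "(\<And>i. i \<in> I \<Longrightarrow> f i \<in> p_integers p) \<Longrightarrow> sum f I \<in> p_integers p"
  by (induction I rule: infinite_finite_induct) auto

lemma p_integers_divide_of_nat [intro]:
  assumes "x \<in> p_integers p" "coprime m p" "m \<noteq> 0"
  shows "x / of_nat m \<in> p_integers p"
proof -
  have "1 / of_nat m \<in> p_integers p" unfolding p_integers_iff
    using assms by (intro exI[of _ 1] exI[of _ "int m"]) simp
  from p_integers_mult[OF assms(1) this] show ?thesis by simp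
qed

lemma coprime_less_prime:
  fixes p k :: nat
  assumes "prime p" "0 < k" "k < p"
  shows "coprime k p" "coprime (p + k) p"
proof -
  have "\<not> p dvd k" using assms by (auto dest: dvd_imp_le)
  thus "coprime k p" using assms(1) by (metis prime_imp_coprime coprime_commute)
  thus "coprime (p + k) p" by (simp only: coprime_iff_gcd_eq_1 add.commute[of p k] gcd_add1)
qed

section \<open>Binomial sums modulo the square of a prime\<close>

text \<open>By Pascal's rule, neighbouring entries of row \<open>p - 1\<close> sum to an entry of
  row \<open>p\<close> that is divisible by \<open>p\<close>, so modulo \<open>p\<close> the row
  alternates in sign, starting from 1.\<close>

lemma choose_prime_minus_1:
  assumes "prime p" "k < p"
  shows "\<exists>m::int. int ((p - 1) choose k) = (-1) ^ k + int p * m"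
  using assms(2)
proof (induction k)
  case 0
  show ?case by (intro exI[of _ 0]) simp
next
  case (Suc k)
  then obtain m where m: "int ((p - 1) choose k) = (-1) ^ k + int p * m" by auto
  have "p dvd (p choose Suc k)"
    using Suc.prems assms(1) by (intro dvd_choose_prime) auto
  then obtain q where q: "p choose Suc k = p * q" by auto
  have "p choose Suc k = ((p - 1) choose k) + ((p - 1) choose Suc k)"
    using Suc.prems by (cases p) auto
  with q have "int ((p - 1) choose k) + int ((p - 1) choose Suc k) = int p * int q"
    by (metis of_nat_add of_nat_mult)
  with m show ?case by (intro exI[of _ "int q - m"]) (simp add: algebra_simps)
qed

text \<open>For \<open>k > 0\<close> the term at \<open>n = 0\<close>, whose denominator is
  \<open>p\<close> itself, vanishes because \<open>0 choose k = 0\<close>.\<close>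

definition binomial_recip_sum :: "nat \<Rightarrow> nat \<Rightarrow> rat" where
  "binomial_recip_sum p k = (\<Sum>n<p. of_nat (n choose k) / of_nat (p + n))"

text \<open>The weights \<open>p + k\<close> and \<open>k + 1\<close> combine the two numerators
  into \<open>(p + n) * (n choose k)\<close>, which cancels the denominator and leaves a plain sum
  of binomial coefficients.\<close>

lemma binomial_recip_sum_rec:
  assumes "p > 0"
  shows "of_nat (p + k) * binomial_recip_sum p k
           + of_nat (Suc k) * binomial_recip_sum p (Suc k) = of_nat (p choose Suc k)"
proof -
  have "of_nat (p + k) * (of_nat (n choose k) / of_nat (p + n))
          + of_nat (Suc k) * (of_nat (n choose Suc k) / of_nat (p + n))
        = (of_nat (n choose k) :: rat)" for n
  proof -
    \<comment> \<open>This is \<open>(k+1) * (n choose k+1) = (n-k) * (n choose k)\<close> without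
      truncated subtraction. For positive \<open>n\<close> and \<open>k\<close>, absorption turns
      both summands into multiples of \<open>n\<close>, and Pascal's rule adds them.\<close>
    have "Suc k * (n choose Suc k) + k * (n choose k) = n * (n choose k)"
    proof (cases n; cases k)
      fix n' k' assume "n = Suc n'" "k = Suc k'"
      moreover have "k * (n choose k) = n * (n' choose k')"
        using calculation Suc_times_binomial_eq[of n' k'] by (simp only: mult_ac)
      moreover have "Suc k * (n choose Suc k) = n * (n' choose k)"
        using calculation Suc_times_binomial_eq[of n' k] by (simp only: mult_ac)
      moreover have "n choose k = (n' choose k) + (n' choose k')"
        using calculation(1,2) by simp
      ultimately show ?thesis by (simp only: distrib_left)
    qed auto
    hence *: "of_nat (Suc k) * of_nat (n choose Suc k) + of_nat k * of_nat (n choose k)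
             = (of_nat n * of_nat (n choose k) :: rat)"
      by (metis of_nat_add of_nat_mult)
    have "of_nat (p + k) * of_nat (n choose k) + of_nat (Suc k) * of_nat (n choose Suc k)
            = (of_nat (p + n) * of_nat (n choose k) :: rat)"
      using * by (simp add: algebra_simps)
    hence "(of_nat (p + k) * of_nat (n choose k) + of_nat (Suc k) * of_nat (n choose Suc k))
             / of_nat (p + n) = (of_nat (n choose k) :: rat)"
      using assms by (simp only:) simp
    thus ?thesis by (simp only: add_divide_distrib times_divide_eq_right)
  qed
  hence "of_nat (p + k) * binomial_recip_sum p k
           + of_nat (Suc k) * binomial_recip_sum p (Suc k) = (\<Sum>n<p. (of_nat (n choose k) :: rat))"
    unfolding binomial_recip_sum_def sum_distrib_left sum.distrib[symmetric] by (intro sum.cong refl)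
  also have "\<dots> = of_nat (\<Sum>n<p. n choose k)" by simp
  \<comment> \<open>The hockey-stick identity.\<close>
  also have "(\<Sum>n<p. n choose k) = p choose Suc k"
    by (induction p) auto
  finally show ?thesis .
qed

text \<open>\<open>D k\<close> is the error divided by \<open>p^2\<close>. The recursion expresses
  \<open>D k\<close> through \<open>D (Suc k)\<close> with p-integral coefficients.\<close>

lemma binomial_recip_sum_cong:
  assumes p: "prime p" "odd p" and "0 < k" "k < p"
  shows "((-1) ^ k * binomial_recip_sum p k - 1 / of_nat (p + k)) / of_nat p ^ 2 \<in> p_integers p"
proof -
  define D where
    "D k = ((-1) ^ k * binomial_recip_sum p k - 1 / of_nat (p + k)) / of_nat p ^ 2" for k
  have p0: "p > 0" using p by (simp add: prime_gt_0_nat)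
  have "k \<le> p - 1" using assms by simp
  hence "D k \<in> p_integers p" using \<open>0 < k\<close>
  proof (induction rule: inc_induct)
    case base
    \<comment> \<open>The descent starts with no error at all: the recursion at \<open>p - 1\<close>
      reads \<open>(2p - 1) * S_{p-1} = 1\<close>, and the sign is +1 because \<open>p - 1\<close>
      is even.\<close>
    have "binomial_recip_sum p p = 0" unfolding binomial_recip_sum_def
      by (intro sum.neutral) auto
    with binomial_recip_sum_rec[OF p0, of "p - 1"] p0
    have "binomial_recip_sum p (p - 1) = 1 / of_nat (p + (p - 1))"
      by (simp add: eq_divide_eq mult.commute del: of_nat_add of_nat_diff)
    moreover have "even (p - 1)" using p by simp
    ultimately have "D (p - 1) = 0" unfolding D_def by simp
    thus ?case by simp
  next
    case (step k)
    have k: "0 < k" "Suc k < p" using step by auto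
    obtain m :: int where m: "int ((p - 1) choose k) = (-1) ^ k + int p * m"
      using choose_prime_minus_1[OF p(1), of k] k by auto
    define e :: rat where "e = (-1) ^ k"
    define P K M S S' C where "P = (of_nat p :: rat)" and "K = (of_nat k :: rat)"
      and "M = (of_int m :: rat)" and "S = binomial_recip_sum p k"
      and "S' = binomial_recip_sum p (Suc k)" and "C = (of_nat (p choose Suc k) :: rat)"
    have ee: "e * e = 1" by (simp add: e_def flip: power_add)
    have P: "P > 0" and K: "K > 0" using p0 k by (simp_all add: P_def K_def)
    have "of_int (int ((p - 1) choose k)) = e + P * M"
      unfolding m by (simp add: e_def P_def M_def)
    moreover have "Suc k * (p choose Suc k) = p * ((p - 1) choose k)"
      using Suc_times_binomial_eq[of "p - 1" k] p0 by simp
    hence "of_nat (Suc k) * C = P * of_nat ((p - 1) choose k)"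
      unfolding C_def P_def by (metis of_nat_mult)
    \<comment> \<open>Hence \<open>p choose k+1\<close> is known modulo \<open>p^2\<close>: it is
      \<open>p * (-1)^k / (k+1)\<close> up to a p-integral multiple of \<open>p^2\<close>.\<close>
    ultimately have C: "(K + 1) * C = P * (e + P * M)"
      by (simp add: K_def add.commute)
    have rec: "(P + K) * S + (K + 1) * S' = C"
      using binomial_recip_sum_rec[OF p0, of k]
      by (simp add: P_def K_def S_def S'_def C_def add.commute)
    have D': "D (Suc k) * P\<^sup>2 = - e * S' - 1 / (P + K + 1)"
      using P by (simp add: D_def P_def K_def e_def S'_def add_ac)
    have Dk: "D k * P\<^sup>2 = e * S - 1 / (P + K)"
      using P by (simp add: D_def P_def K_def e_def S_def)
    have "(P + K) * (D k * P\<^sup>2) = e * ((P + K) * S) - 1"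
      unfolding Dk using P K by (simp add: algebra_simps add_divide_distrib[symmetric])
    also have "(P + K) * S = C - (K + 1) * S'" using rec by simp
    also have "C = P * (e + P * M) / (K + 1)" using C K by (simp add: field_simps)
    also have "e * (P * (e + P * M) / (K + 1) - (K + 1) * S') - 1
        = P * (e * e + P * (e * M)) / (K + 1) + (K + 1) * (- e * S') - 1"
      using K by (simp add: divide_simps) (simp add: algebra_simps)
    also have "- e * S' = D (Suc k) * P\<^sup>2 + 1 / (P + K + 1)" using D' by simp
    \<comment> \<open>With \<open>e * e = 1\<close>, the terms lacking a visible factor
      \<open>P^2\<close> cancel down to one:
      \<open>P/(K+1) + (K+1)/(P+K+1) - 1 = P^2 / ((K+1)(P+K+1))\<close>.\<close>
    also have "P * (e * e + P * (e * M)) / (K + 1)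
          + (K + 1) * (D (Suc k) * P\<^sup>2 + 1 / (P + K + 1)) - 1
        = (e * M / (K + 1) + (K + 1) * D (Suc k) + 1 / (K + 1) / (P + K + 1)) * P\<^sup>2"
      using P K unfolding ee by (simp add: divide_simps) (simp add: algebra_simps power2_eq_square)
    finally have "P\<^sup>2 * ((P + K) * D k)
        = P\<^sup>2 * (e * M / (K + 1) + (K + 1) * D (Suc k) + 1 / (K + 1) / (P + K + 1))"
      by (simp only: mult_ac)
    hence "(P + K) * D k = e * M / (K + 1) + (K + 1) * D (Suc k) + 1 / (K + 1) / (P + K + 1)"
      using P by (subst (asm) mult_cancel_left) simp
    hence "D k = (e * M / (K + 1) + (K + 1) * D (Suc k) + 1 / (K + 1) / (P + K + 1)) / (P + K)"
      using P K by (subst eq_divide_eq) (simp add: mult.commute)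
    also have "\<dots> = (of_int ((-1) ^ k * m) / of_nat (Suc k) + of_nat (Suc k) * D (Suc k)
                       + 1 / of_nat (Suc k) / of_nat (p + Suc k)) / of_nat (p + k)"
      by (simp add: P_def K_def e_def M_def add_ac)
    \<comment> \<open>The denominators left are \<open>k+1\<close>, \<open>p+k+1\<close> and
      \<open>p+k\<close>, all coprime to \<open>p\<close> since \<open>0 < k\<close> and
      \<open>k+1 < p\<close>.\<close>
    also have "\<dots> \<in> p_integers p"
      using step k by (intro p_integers_divide_of_nat p_integers_add p_integers_mult
        coprime_less_prime p p_integers_of_int p_integers_of_nat p_integers_1) auto
    finally show ?case .
  qed
  thus ?thesis by (simp add: D_def)
qed

theorem theorem4p1:
  fixes p :: nat and A :: "nat \<Rightarrow> rat"
  assumes "prime p" and "odd p"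
    and "odd_sequence A"
    and "\<And>k. A k \<in> p_integers p"
  shows "p_cong p 2 (\<Sum>k=1..p-1. A k / of_nat (p + k)) 0"
proof -
  define L where "L = (\<Sum>k=1..p-1. A k / of_nat (p + k))"
  have p0: "p > 0" using assms(1) by (simp add: prime_gt_0_nat)
  have odd: "A n = - (\<Sum>k=0..n. of_nat (n choose k) * (-1) ^ k * A k)" for n
    using assms(3) unfolding odd_sequence_def by simp
  \<comment> \<open>At \<open>n = 0\<close> oddness reads \<open>A 0 = - A 0\<close>. So sums over
    \<open>k < p\<close> may drop the index 0, where \<open>1/(p+k)\<close> is not
    p-integral.\<close>
  have A0: "A 0 = 0" using odd[of 0] by simp
  have split: "(\<Sum>k<p. f k) = (\<Sum>k=1..p-1. f k)" if "f 0 = 0" for f :: "nat \<Rightarrow> rat"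
    using that by (intro sum.mono_neutral_right) (auto simp: Suc_le_eq intro: Suc_leI)
  have "L = (\<Sum>n<p. A n / of_nat (p + n))"
    unfolding L_def by (rule split[symmetric]) (simp add: A0)
  also have "\<dots> = (\<Sum>n<p. \<Sum>k<p. - ((-1) ^ k * A k * (of_nat (n choose k) / of_nat (p + n))))"
  proof (intro sum.cong refl)
    fix n assume "n \<in> {..<p}"
    \<comment> \<open>Terms with \<open>k > n\<close> are zero, so the inner range can be made
      independent of \<open>n\<close>, ready for the interchange of summation.\<close>
    hence "(\<Sum>k=0..n. of_nat (n choose k) * (-1) ^ k * A k)
             = (\<Sum>k<p. of_nat (n choose k) * (-1) ^ k * A k)"
      by (intro sum.mono_neutral_left) auto
    thus "A n / of_nat (p + n)
            = (\<Sum>k<p. - ((-1) ^ k * A k * (of_nat (n choose k) / of_nat (p + n))))"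
      by (subst odd) (simp add: sum_divide_distrib sum_negf mult_ac)
  qed
  also have "\<dots> = (\<Sum>k<p. - ((-1) ^ k * binomial_recip_sum p k * A k))"
    by (subst sum.swap) (simp add: binomial_recip_sum_def sum_distrib_left sum_distrib_right
        sum_negf mult_ac)
  also have "\<dots> = (\<Sum>k=1..p-1. - ((-1) ^ k * binomial_recip_sum p k * A k))"
    by (rule split) (simp add: A0)
  \<comment> \<open>Adding \<open>L\<close> to its transformed version pairs each
    \<open>1/(p+k)\<close> with the quantity congruent to it, so \<open>2 * L\<close> becomes a
    combination of the errors.\<close>
  finally have "2 * L = (\<Sum>k=1..p-1. A k / of_nat (p + k))
                         + (\<Sum>k=1..p-1. - ((-1) ^ k * binomial_recip_sum p k * A k))"
    by (simp add: L_def)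
  also have "\<dots> = (\<Sum>k=1..p-1.
      - A k * ((-1) ^ k * binomial_recip_sum p k - 1 / of_nat (p + k)))"
    unfolding sum.distrib[symmetric] by (intro sum.cong refl) (simp add: algebra_simps)
  finally have L2: "2 * L = (\<Sum>k=1..p-1.
      - A k * ((-1) ^ k * binomial_recip_sum p k - 1 / of_nat (p + k)))" .
  \<comment> \<open>Halving preserves p-integrality because \<open>p\<close> is odd.\<close>
  have "L / of_nat p ^ 2 = 2 * L / of_nat p ^ 2 / of_nat 2" by simp
  also have "\<dots> = (\<Sum>k=1..p-1.
      - A k * ((-1) ^ k * binomial_recip_sum p k - 1 / of_nat (p + k))) / of_nat p ^ 2 / of_nat 2"
    by (simp only: L2)
  also have "\<dots> = (\<Sum>k=1..p-1.
      - A k * (((-1) ^ k * binomial_recip_sum p k - 1 / of_nat (p + k)) / of_nat p ^ 2)) / of_nat 2"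
    by (simp only: sum_divide_distrib times_divide_eq_right)
  also have "\<dots> \<in> p_integers p"
  proof (rule p_integers_divide_of_nat)
    show "(\<Sum>k=1..p-1. - A k * (((-1) ^ k * binomial_recip_sum p k - 1 / of_nat (p + k))
            / of_nat p ^ 2)) \<in> p_integers p"
      using assms p0 by (intro p_integers_sum p_integers_mult p_integers_uminus
          binomial_recip_sum_cong) auto
    show "coprime 2 p" using assms(2) by simp
  qed simp
  finally have "L / of_nat p ^ 2 \<in> p_integers p" .
  \<comment> \<open>\<open>p_cong\<close> also asks that the sum itself be a p-integer, which holds
    since its denominators \<open>p + k\<close> are coprime to \<open>p\<close>.\<close>
  moreover have "L \<in> p_integers p" unfolding L_def
  proof (intro p_integers_sum p_integers_divide_of_nat)
    fix k assume "k \<in> {1..p-1}"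
    thus "coprime (p + k) p" using assms(1) by (intro coprime_less_prime(2)) auto
  qed (use p0 assms in auto)
  ultimately show ?thesis by (simp add: p_cong_def L_def)
qed

end
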